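(* (Constrained control protocols in the Szilard engine.) Let $\mathcal{X}=\mathcal{Y}=\{L,R\}$, let $(X_1,Y_1),\dots,(X_n,Y_n)$ be i.i.d. pairs with law $P_{X,Y}$ on $\mathcal{X}\times\mathcal{Y}$, with $P_X(x)>0$ and $P_Y(y)>0$ for all $x,y$, and let $k_BT>0$. Let $\mathcal{V}$ be a nonempty set of probability vectors on $\mathcal{X}$ (the allowed partitions of the box) such that the minima below are attained. Suppose that for each $y$ the controller chooses $v_f(\cdot|y)\in\mathcal{V}$, and that the total extracted work is $W_n=\sum_{i=1}^n k_BT\ln\frac{v_f(X_i|Y_i)}{P_X(X_i)}$. Then $$\max_{v_f\in\mathcal{V}}E[W_n]=n k_BT\Big(I(X;Y)-\sum_{y\in\mathcal{Y}}P_Y(y)\min_{v_f(\cdot|y)\in\mathcal{V}}D(P_{X|y}||v_f(\cdot|y))\Big),$$ where the maximum on the left is over all choices with $v_f(\cdot|y)\in\mathcal{V}$ for each $y$; and for each $y$ the optimal $v_f(\cdot|y)\in\mathcal{V}$ is one that minimizes $D(P_{X|y}||v_f(\cdot|y))$.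
   Context: In the Szilard engine, a single particle is in a box divided into two parts; $X$ is the part containing the particle, $Y$ a noisy measurement of $X$, $P_X(x)$ equals the initial normalized volume of part $x$, and $v_f(x|y)$ is the final normalized volume of part $x$ after measurement $y$. $P_{X|y}$ is the conditional distribution of $X$ given $Y=y$. $I(X;Y)$ is Shannon's mutual information and $D(P||Q)=\sum_xP(x)\ln\frac{P(x)}{Q(x)}$ (possibly $+\infty$) the Kullback-Leibler divergence, both in nats.
   Formalization: That every optimal choice minimizes the divergence for each y is stated only when all the minima are finite; if some minimum is +∞, the maximum is −∞, every choice is optimal, and the claim can fail. That minimizers are optimal, and the formula, hold without this condition. *)

theory Defs
  imports "HOL-Probability.Probability"
begin

datatype part = L | R

lemma UNIV_part: "(UNIV :: part set) = {L, R}"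
  by (auto intro: part.exhaust)

instance part :: finite
  by standard (simp add: UNIV_part)

text \<open>The library's \<^const>\<open>ln\<close> on the reals has \<open>ln 0 = 0\<close>; here \<open>eln 0 = - \<infinity>\<close> is needed.\<close>

definition eln :: "ereal \<Rightarrow> ereal" where
  "eln x = (if x \<le> 0 then - \<infinity> else if x = \<infinity> then \<infinity> else ereal (ln (real_of_ereal x)))"

text \<open>The usual conventions come from \<^typ>\<open>ereal\<close>: \<open>p / 0 = \<infinity>\<close> for \<open>p > 0\<close>, so a term with
  \<open>P x > 0 = Q x\<close> is \<open>\<infinity>\<close>; and \<open>0 * a = 0\<close> for every \<open>a\<close>, so a term with \<open>P x = 0\<close> is \<open>0\<close>.
  (The library's \<open>KL_divergence\<close> is real-valued and cannot be \<open>\<infinity>\<close>.)\<close>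

definition KL_div :: "'a::finite pmf \<Rightarrow> 'a pmf \<Rightarrow> ereal" where
  "KL_div P Q = (\<Sum>x\<in>UNIV. ereal (pmf P x) * eln (ereal (pmf P x) / ereal (pmf Q x)))"

lemma KL_div_alt:
  "KL_div P Q = (\<Sum>x\<in>UNIV. if pmf P x = 0 then 0 else if pmf Q x = 0 then \<infinity>
                  else ereal (pmf P x * ln (pmf P x / pmf Q x)))"
proof -
  have "ereal p * eln (ereal p / ereal q) =
      (if p = 0 then 0 else if q = 0 then \<infinity> else ereal (p * ln (p / q)))"
    if "p \<ge> 0" "q \<ge> 0" for p q :: real
    using that by (auto simp: eln_def divide_ereal_def not_le divide_le_0_iff field_simps)
  then show ?thesis
    unfolding KL_div_def by (intro sum.cong) auto
qed

definition cond_X :: "('a \<times> 'b) pmf \<Rightarrow> 'b \<Rightarrow> 'a pmf" where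
  "cond_X P y = map_pmf fst (cond_pmf P {p. snd p = y})"

text \<open>Base \<open>exp 1\<close>: information is measured in nats.\<close>

definition mutual_inf :: "('a \<times> 'b) pmf \<Rightarrow> real" where
  "mutual_inf P = prob_space.mutual_information (measure_pmf P) (exp 1)
     (count_space UNIV) (count_space UNIV) fst snd"

text \<open>Expectation of an extended-real random variable as \<open>E[W\<^sup>+] - E[W\<^sup>-]\<close>; \<^const>\<open>e2ennreal\<close>
  sends negative values to \<open>0\<close>. Meaningful unless both parts are infinite, which cannot happen
  for the work below because it is bounded above.\<close>

definition expectation_ereal :: "'w measure \<Rightarrow> ('w \<Rightarrow> ereal) \<Rightarrow> ereal" where
  "expectation_ereal M W =
     enn2ereal (\<integral>\<^sup>+ \<omega>. e2ennreal (W \<omega>) \<partial>M) - enn2ereal (\<integral>\<^sup>+ \<omega>. e2ennreal (- W \<omega>) \<partial>M)"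

definition iid_pairs ::
  "'w measure \<Rightarrow> nat \<Rightarrow> (nat \<Rightarrow> 'w \<Rightarrow> 'a) \<Rightarrow> (nat \<Rightarrow> 'w \<Rightarrow> 'b) \<Rightarrow> ('a \<times> 'b) pmf \<Rightarrow> bool" where
  "iid_pairs M n X Y P \<longleftrightarrow>
     prob_space.indep_vars M (\<lambda>_. count_space UNIV) (\<lambda>i \<omega>. (X i \<omega>, Y i \<omega>)) {1..n} \<and>
     (\<forall>i\<in>{1..n}. distr M (count_space UNIV) (\<lambda>\<omega>. (X i \<omega>, Y i \<omega>)) = measure_pmf P)"

text \<open>\<open>vf y\<close> is the distribution \<open>v\<^sub>f(\<cdot>|y)\<close>; the work is \<open>- \<infinity>\<close> as soon as one of the parts
  found to contain the particle has final volume \<open>0\<close>.\<close>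

definition work ::
  "real \<Rightarrow> 'a pmf \<Rightarrow> ('b \<Rightarrow> 'a pmf) \<Rightarrow> nat \<Rightarrow> (nat \<Rightarrow> 'w \<Rightarrow> 'a) \<Rightarrow> (nat \<Rightarrow> 'w \<Rightarrow> 'b) \<Rightarrow> 'w \<Rightarrow> ereal"
  where
  "work kBT PX vf n X Y \<omega> =
     (\<Sum>i\<in>{1..n}. ereal kBT * eln (ereal (pmf (vf (Y i \<omega>)) (X i \<omega>)) / ereal (pmf PX (X i \<omega>))))"

end

theory Submission
  imports Defs
begin

text \<open>
  Writing \<open>v\<^sub>f(x|y) / P\<^sub>X(x) = P(x,y) / (P\<^sub>X(x) P\<^sub>Y(y)) \<cdot> v\<^sub>f(x|y) / P(x|y)\<close> and taking
  \<open>E[ln]\<close> gives \<open>E[W\<^sub>n] = n k\<^sub>BT (I(X;Y) - \<Sum>\<^sub>y P\<^sub>Y(y) D(P\<^bsub>X|y\<^esub> || v\<^sub>f(\<cdot>|y)))\<close>, where both sides are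
  \<open>- \<infinity>\<close> as soon as \<open>v\<^sub>f(x|y) = 0\<close> for some \<open>(x,y)\<close> of positive probability. The terms of the sum
  depend on separate choices \<open>v\<^sub>f(\<cdot>|y)\<close> and have positive weights, so the sum is minimized termwise.
\<close>

section \<open>Finite sums with infinite terms\<close>

lemma sum_ereal_eq_MInf:
  fixes f :: "'a \<Rightarrow> ereal"
  assumes "finite A" "\<And>a. a \<in> A \<Longrightarrow> f a \<noteq> \<infinity>" "a \<in> A" "f a = -\<infinity>"
  shows "sum f A = -\<infinity>"
proof -
  \<comment> \<open>In \<open>ereal\<close>,
    \<open>\<infinity> + (-\<infinity>) = \<infinity>\<close>, so the term
    \<open>-\<infinity>\<close> absorbs the remaining ones only once these are known not to sum to
    \<open>\<infinity>\<close>.\<close>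
  have "sum f (A - {a}) \<noteq> \<infinity>"
    using assms(2) by (auto simp: sum_Pinfty)
  then show ?thesis
    using assms by (simp add: sum.remove[of A a])
qed

lemma sum_ereal_neq_MInf:
  fixes f :: "'a \<Rightarrow> ereal"
  assumes "\<And>a. a \<in> A \<Longrightarrow> f a \<noteq> -\<infinity>"
  shows "sum f A \<noteq> -\<infinity>"
  using assms by (induction A rule: infinite_finite_induct) auto

section \<open>Conditional law and mutual information as elementary expressions\<close>

lemma pmf_cond_X:
  assumes "pmf (map_pmf snd P) y > 0"
  shows "pmf (cond_X P y) x = pmf P (x :: 'a :: finite, y) / pmf (map_pmf snd P) y"
proof -
  have eq: "{p. snd p = y} = snd -` {y}"
    by auto
  have ne: "set_pmf P \<inter> {p. snd p = y} \<noteq> {}"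
    using assms by (auto simp: set_pmf_iff[symmetric] pmf_positive_iff)
  have vim: "fst -` {x} = (\<lambda>y. (x, y)) ` UNIV"
    by auto
  \<comment> \<open>The conditioned law lives on pairs with second component \<open>y\<close>, so
    there the event that the first component is \<open>x\<close> is almost surely the single point
    \<open>(x, y)\<close>.\<close>
  have "pmf (cond_X P y) x = measure (cond_pmf P {p. snd p = y}) {(x, y)}"
    unfolding cond_X_def pmf_map
    by (rule measure_pmf.finite_measure_eq_AE)
      (auto simp: AE_measure_pmf_iff set_cond_pmf[OF ne])
  also have "\<dots> = pmf P (x, y) / measure P {p. snd p = y}"
    by (simp add: measure_pmf_single pmf_cond[OF ne])
  finally show ?thesis
    by (simp add: pmf_map eq)
qed

text \<open>The joint law and both marginals have their mass functions as densities with respect to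
  counting measure, so the integral formula for mutual information collapses to a finite
  sum.\<close>

lemma mutual_inf_eq_sum:
  fixes P :: "('a::finite \<times> 'b::finite) pmf"
  shows "mutual_inf P = (\<Sum>(x, y)\<in>UNIV. pmf P (x, y) *
    ln (pmf P (x, y) / (pmf (map_pmf fst P) x * pmf (map_pmf snd P) y)))"
proof -
  interpret information_space "measure_pmf P" "exp 1"
    by unfold_locales simp
  have pair: "count_space UNIV \<Otimes>\<^sub>M count_space UNIV = count_space (UNIV :: ('a \<times> 'b) set)"
    by (simp add: pair_measure_count_space)
  have dist: "distributed (measure_pmf P) (count_space UNIV) f (\<lambda>x. ennreal (pmf (map_pmf f P) x))"
    for f :: "'a \<times> 'b \<Rightarrow> 'c"
    by (simp add: distributed_def map_pmf_rep_eq[symmetric] measure_pmf_eq_density[symmetric])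
  have joint: "distributed (measure_pmf P) (count_space UNIV \<Otimes>\<^sub>M count_space UNIV)
      (\<lambda>p. (fst p, snd p)) (\<lambda>x. ennreal (pmf P x))"
    using dist[of "\<lambda>p. p"] by (simp add: pair map_pmf_ident)
  have "mutual_inf P = (\<integral>z. (\<lambda>(x, y). pmf P (x, y) *
    log (exp 1) (pmf P (x, y) / (pmf (map_pmf fst P) x * pmf (map_pmf snd P) y))) z
    \<partial>(count_space UNIV \<Otimes>\<^sub>M count_space UNIV))"
    unfolding mutual_inf_def
    by (subst mutual_information_distr[OF _ _ dist _ dist _ joint])
      (auto simp: sigma_finite_measure_count_space_finite split_beta')
  also have "\<dots> = (\<Sum>(x, y)\<in>UNIV. pmf P (x, y) *
    ln (pmf P (x, y) / (pmf (map_pmf fst P) x * pmf (map_pmf snd P) y)))"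
    by (simp add: pair lebesgue_integral_count_space_finite log_def)
  finally show ?thesis .
qed

section \<open>Expectation of extended-real random variables\<close>

lemma expectation_ereal_cong_AE:
  assumes "AE \<omega> in M. W \<omega> = W' \<omega>"
  shows "expectation_ereal M W = expectation_ereal M W'"
proof -
  have "(\<integral>\<^sup>+ \<omega>. e2ennreal (W \<omega>) \<partial>M) = (\<integral>\<^sup>+ \<omega>. e2ennreal (W' \<omega>) \<partial>M)"
    "(\<integral>\<^sup>+ \<omega>. e2ennreal (- W \<omega>) \<partial>M) = (\<integral>\<^sup>+ \<omega>. e2ennreal (- W' \<omega>) \<partial>M)"
    using assms by (auto intro!: nn_integral_cong_AE)
  then show ?thesis
    by (simp add: expectation_ereal_def)
qed

lemma expectation_ereal_integrable:
  assumes "integrable M f"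
  shows "expectation_ereal M (\<lambda>\<omega>. ereal (f \<omega>)) = ereal (integral\<^sup>L M f)"
proof -
  have "(\<integral>\<^sup>+ \<omega>. ennreal (f \<omega>) \<partial>M) < \<infinity>" "(\<integral>\<^sup>+ \<omega>. ennreal (- f \<omega>) \<partial>M) < \<infinity>"
    using assms by (auto simp: real_integrable_def less_top)
  then obtain a b where "0 \<le> a" "0 \<le> b" "(\<integral>\<^sup>+ \<omega>. ennreal (f \<omega>) \<partial>M) = ennreal a" "(\<integral>\<^sup>+ \<omega>. ennreal (- f \<omega>) \<partial>M) = ennreal b"
    by (metis ennreal_cases infinity_ennreal_def less_irrefl)
  then show ?thesis
    using real_lebesgue_integral_def[OF assms]
    by (simp add: expectation_ereal_def)
qed

text \<open>The upper bound and the finiteness of the measure make the positive part integrable,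
  while the negative part is infinite on a set of positive measure; the difference is then a finite
  number minus \<open>\<infinity>\<close>.\<close>

lemma expectation_ereal_eq_MInf:
  assumes "finite_measure M" "\<And>\<omega>. \<omega> \<in> space M \<Longrightarrow> W \<omega> \<le> ereal C"
    and "A \<in> sets M" "emeasure M A > 0" "\<And>\<omega>. \<omega> \<in> A \<Longrightarrow> W \<omega> = -\<infinity>"
  shows "expectation_ereal M W = -\<infinity>"
proof -
  interpret finite_measure M by fact
  have "(\<integral>\<^sup>+ \<omega>. e2ennreal (W \<omega>) \<partial>M) \<le> (\<integral>\<^sup>+ \<omega>. ennreal C \<partial>M)"
    using assms(2) by (intro nn_integral_mono) (metis e2ennreal_mono e2ennreal_ereal)
  also have "\<dots> < \<infinity>"
    by (simp add: ennreal_mult_less_top less_top[symmetric] emeasure_eq_measure ennreal_mult_eq_top_iff)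
  finally have "enn2ereal (\<integral>\<^sup>+ \<omega>. e2ennreal (W \<omega>) \<partial>M) \<noteq> \<infinity>"
    by (auto simp: less_top[symmetric])
  moreover have "(\<integral>\<^sup>+ \<omega>. top * indicator A \<omega> \<partial>M) \<le> (\<integral>\<^sup>+ \<omega>. e2ennreal (- W \<omega>) \<partial>M)"
    using assms(5) by (intro nn_integral_mono) (auto split: split_indicator)
  then have "(\<integral>\<^sup>+ \<omega>. e2ennreal (- W \<omega>) \<partial>M) = top"
    using assms(4) unfolding nn_integral_cmult_indicator[OF assms(3)]
    by (simp add: ennreal_top_mult top_unique split: if_splits)
  ultimately show ?thesis
    by (cases "enn2ereal (\<integral>\<^sup>+ \<omega>. e2ennreal (W \<omega>) \<partial>M)") (auto simp: expectation_ereal_def)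
qed

text \<open>If \<open>-\<infinity>\<close> is taken with positive probability, one summand alone
  forces the value. Otherwise the sum is almost surely real, and linearity with transfer to the law
  \<open>P\<close> applies.\<close>

lemma expectation_ereal_sum_identically_distributed:
  fixes Z :: "'i \<Rightarrow> 'w \<Rightarrow> 'c::finite" and g :: "'c \<Rightarrow> ereal"
  assumes "finite I" "I \<noteq> {}"
    and meas [measurable]: "\<And>i. i \<in> I \<Longrightarrow> Z i \<in> measurable M (count_space UNIV)"
    and distr: "\<And>i. i \<in> I \<Longrightarrow> distr M (count_space UNIV) (Z i) = measure_pmf P"
    and g: "\<And>c. g c \<noteq> \<infinity>"
  shows "expectation_ereal M (\<lambda>\<omega>. \<Sum>i\<in>I. g (Z i \<omega>)) =
    (if \<exists>c\<in>set_pmf P. g c = -\<infinity> then -\<infinity>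
     else ereal (real (card I) * (\<Sum>c\<in>UNIV. pmf P c * real_of_ereal (g c))))"
proof (cases "\<exists>c\<in>set_pmf P. g c = -\<infinity>")
  case True
  then obtain c where c: "c \<in> set_pmf P" "g c = -\<infinity>"
    by blast
  obtain i where i: "i \<in> I"
    using \<open>I \<noteq> {}\<close> by blast
  \<comment> \<open>The total mass of \<open>M\<close> is read off from the law of one
    \<open>Z i\<close>.\<close>
  have ps: "prob_space M"
  proof
    show "emeasure M (space M) = 1"
      using distr[OF i] emeasure_distr[OF meas[OF i], of UNIV]
      by (simp add: measure_pmf.emeasure_space_1[simplified] vimage_def)
  qed
  \<comment> \<open>The maximum exists because the type of values is finite. A value
    \<open>-\<infinity>\<close> enters as \<open>0\<close>, which can only enlarge the
    bound.\<close>
  define C where "C = Max (range (\<lambda>c. real_of_ereal (g c)))"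
  have "g c \<le> ereal C" for c
  proof -
    have "real_of_ereal (g c) \<le> C"
      by (simp add: C_def)
    then show ?thesis
      using g[of c] by (cases "g c") auto
  qed
  then have "(\<Sum>i\<in>I. g (Z i \<omega>)) \<le> (\<Sum>i\<in>I. ereal C)" for \<omega>
    by (intro sum_mono)
  then have ub: "(\<Sum>i\<in>I. g (Z i \<omega>)) \<le> ereal (real (card I) * C)" for \<omega>
    by simp
  have "emeasure M (Z i -` {c} \<inter> space M) = emeasure (measure_pmf P) {c}"
    using distr[OF i] emeasure_distr[OF meas[OF i], of "{c}"] by simp
  also have "\<dots> > 0"
    using c(1) by (simp add: emeasure_pmf_single pmf_positive)
  finally have "expectation_ereal M (\<lambda>\<omega>. \<Sum>i\<in>I. g (Z i \<omega>)) = -\<infinity>"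
    using ps i c g \<open>finite I\<close>
    by (intro expectation_ereal_eq_MInf[OF _ ub, where A = "Z i -` {c} \<inter> space M"])
      (auto intro!: sum_ereal_eq_MInf measurable_sets[OF meas] simp: prob_space.finite_measure)
  then show ?thesis
    using True by simp
next
  case False
  \<comment> \<open>Here \<open>g\<close> is \<open>-\<infinity>\<close> only at points of
    probability \<open>0\<close>, so the default value \<open>0\<close> given by
    \<open>real_of_ereal\<close> affects neither the integral nor the weighted sum.\<close>
  let ?h = "\<lambda>c. real_of_ereal (g c)"
  have fin: "ereal (?h c) = g c" if "c \<in> set_pmf P" for c
    using False g[of c] that by (cases "g c") auto
  have "AE \<omega> in M. Z i \<omega> \<in> set_pmf P" if "i \<in> I" for i
    using AE_distrD[OF meas[OF that], of "\<lambda>c. c \<in> set_pmf P"] distr[OF that]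
    by (metis AE_measure_pmf)
  then have "AE \<omega> in M. \<forall>i\<in>I. Z i \<omega> \<in> set_pmf P"
    using \<open>finite I\<close> by (simp add: AE_finite_all)
  then have AE: "AE \<omega> in M. (\<Sum>i\<in>I. g (Z i \<omega>)) = ereal (\<Sum>i\<in>I. ?h (Z i \<omega>))"
    by (rule AE_mp) (auto simp: fin sum_ereal[symmetric] simp del: sum_ereal intro!: sum.cong)
  have int: "integrable M (\<lambda>\<omega>. ?h (Z i \<omega>))" if "i \<in> I" for i
    using integrable_distr_eq[OF meas[OF that], of ?h] distr[OF that]
    by (simp add: integrable_measure_pmf_finite)
  have "(\<integral>\<omega>. ?h (Z i \<omega>) \<partial>M) = (\<Sum>c\<in>UNIV. pmf P c * ?h c)" if "i \<in> I" for i
    using integral_distr[OF meas[OF that], of ?h] distr[OF that]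
    by (simp add: integral_measure_pmf_real[of UNIV] mult.commute)
  then have "(\<integral>\<omega>. (\<Sum>i\<in>I. ?h (Z i \<omega>)) \<partial>M) = real (card I) * (\<Sum>c\<in>UNIV. pmf P c * ?h c)"
    by (simp add: int)
  then show ?thesis
    using False int by (simp add: expectation_ereal_cong_AE[OF AE] expectation_ereal_integrable)
qed

section \<open>Finite and infinite values of the divergence\<close>

lemma KL_div_eq_real:
  assumes "\<And>x. pmf P x > 0 \<Longrightarrow> pmf Q x > 0"
  shows "KL_div P Q = ereal (\<Sum>x\<in>UNIV. pmf P x * ln (pmf P x / pmf Q x))"
  unfolding KL_div_alt sum_ereal[symmetric]
proof (intro sum.cong refl)
  fix x
  show "(if pmf P x = 0 then 0 else if pmf Q x = 0 then \<infinity>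
                  else ereal (pmf P x * ln (pmf P x / pmf Q x))) = ereal (pmf P x * ln (pmf P x / pmf Q x))"
    using assms[of x] by (auto simp: order_less_le)
qed

lemma KL_div_eq_PInf_iff: "KL_div P Q = \<infinity> \<longleftrightarrow> (\<exists>x. pmf P x > 0 \<and> pmf Q x = 0)"
proof -
  have "pmf P x > 0 \<longleftrightarrow> pmf P x \<noteq> 0" for x
    by (simp add: order_less_le)
  then show ?thesis
    by (simp add: KL_div_alt sum_Pinfty) metis
qed

text \<open>A divergence other than \<open>\<infinity>\<close> means absolute continuity, and then
  it is a finite sum of reals.\<close>

lemma KL_div_neq_MInf: "KL_div P Q \<noteq> -\<infinity>"
proof (cases "KL_div P Q = \<infinity>")
  case False
  then show ?thesis
    by (subst KL_div_eq_real) (auto simp: KL_div_eq_PInf_iff order_less_le)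
qed simp

section \<open>Expected work for a fixed protocol\<close>

lemma expectation_work:
  fixes P :: "('a::finite \<times> 'b::finite) pmf" and vf :: "'b \<Rightarrow> 'a pmf"
  assumes "prob_space M" "n \<ge> 1" "kBT > 0" "iid_pairs M n X Y P"
    and PX: "\<And>x. pmf (map_pmf fst P) x > 0"
    and PY: "\<And>y. pmf (map_pmf snd P) y > 0"
  shows "expectation_ereal M (work kBT (map_pmf fst P) vf n X Y) =
    ereal (real n * kBT) * (ereal (mutual_inf P)
      - (\<Sum>y\<in>UNIV. ereal (pmf (map_pmf snd P) y) * KL_div (cond_X P y) (vf y)))"
    (is "?E = _ * (_ - ?S)")
proof -
  let ?pX = "pmf (map_pmf fst P)" and ?pY = "pmf (map_pmf snd P)"
  define g where "g = (\<lambda>(x, y). ereal kBT * eln (ereal (pmf (vf y) x) / ereal (?pX x)))"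
  define Z where "Z = (\<lambda>i \<omega>. (X i \<omega>, Y i \<omega>))"
  have g_eq: "g (x, y) = (if pmf (vf y) x = 0 then -\<infinity> else ereal (kBT * ln (pmf (vf y) x / ?pX x)))"
    for x y
    using PX[of x] \<open>kBT > 0\<close> pmf_nonneg[of "vf y" x]
    by (auto simp: g_def eln_def divide_le_0_iff)
  have cond: "pmf (cond_X P y) x = pmf P (x, y) / ?pY y" for x y
    by (rule pmf_cond_X[OF PY])
  \<comment> \<open>This matches the two sources of infinity: \<open>vf y\<close> vanishing at
    \<open>x\<close> for a possible pair \<open>(x, y)\<close>, and the failure of absolute
    continuity in the divergence for \<open>y\<close>.\<close>
  have cond_pos: "pmf (cond_X P y) x > 0 \<longleftrightarrow> (x, y) \<in> set_pmf P" for x y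
    using PY[of y] by (simp add: cond pmf_positive_iff zero_less_divide_iff)
  have [measurable]: "i \<in> {1..n} \<Longrightarrow> Z i \<in> measurable M (count_space UNIV)"
    and "i \<in> {1..n} \<Longrightarrow> distr M (count_space UNIV) (Z i) = measure_pmf P" for i
    using assms(4) unfolding iid_pairs_def prob_space.indep_vars_def2[OF assms(1)] Z_def by auto
  moreover have "work kBT (map_pmf fst P) vf n X Y = (\<lambda>\<omega>. \<Sum>i\<in>{1..n}. g (Z i \<omega>))"
    by (simp add: work_def[abs_def] Z_def g_def)
  moreover have "g c \<noteq> \<infinity>" for c
    by (cases c) (simp add: g_eq)
  ultimately have E: "?E = (if \<exists>c\<in>set_pmf P. g c = -\<infinity> then -\<infinity>
     else ereal (real n * (\<Sum>c\<in>UNIV. pmf P c * real_of_ereal (g c))))"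
    using expectation_ereal_sum_identically_distributed[of "{1..n}" Z M P g] \<open>n \<ge> 1\<close>
    by simp
  show ?thesis
  proof (cases "\<exists>c\<in>set_pmf P. g c = -\<infinity>")
    case True
    then obtain x y where "(x, y) \<in> set_pmf P" "pmf (vf y) x = 0"
      by (auto simp: g_eq split: if_splits)
    then have "KL_div (cond_X P y) (vf y) = \<infinity>"
      by (auto simp: KL_div_eq_PInf_iff cond_pos)
    then have "ereal (?pY y) * KL_div (cond_X P y) (vf y) = \<infinity>"
      using PY[of y] by simp
    then have "?S = \<infinity>"
      by (auto simp: sum_Pinfty)
    then show ?thesis
      using E True \<open>kBT > 0\<close> \<open>n \<ge> 1\<close> by simp
  next
    case False
    then have pos: "pmf (vf y) x > 0" if "(x, y) \<in> set_pmf P" for x y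
      using that pmf_nonneg[of "vf y" x] by (force simp: g_eq order_less_le)
    have "KL_div (cond_X P y) (vf y) =
        ereal (\<Sum>x\<in>UNIV. pmf (cond_X P y) x * ln (pmf (cond_X P y) x / pmf (vf y) x))" for y
      by (rule KL_div_eq_real) (simp only: cond_pos pos)
    then have "?S = (\<Sum>y\<in>UNIV. ereal (?pY y * (\<Sum>x\<in>UNIV. pmf (cond_X P y) x * ln (pmf (cond_X P y) x / pmf (vf y) x))))"
      by simp
    \<comment> \<open>The weight \<open>?pY y\<close> cancels the denominator of the outer
      conditional probability, leaving the joint probability as weight.\<close>
    also have "\<dots> = ereal (\<Sum>y\<in>UNIV. \<Sum>x\<in>UNIV. pmf P (x, y) * ln (pmf P (x, y) / ?pY y / pmf (vf y) x))"
      using PY by (simp add: sum_distrib_left cond less_imp_neq[symmetric])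
    also have "\<dots> = ereal (\<Sum>(x, y)\<in>UNIV. pmf P (x, y) * ln (pmf P (x, y) / ?pY y / pmf (vf y) x))"
      by (subst sum.swap) (simp add: sum.cartesian_product)
    finally have S: "?S = \<dots>" .
    have "(\<Sum>c\<in>UNIV. pmf P c * real_of_ereal (g c)) =
        (\<Sum>(x, y)\<in>UNIV. kBT * (pmf P (x, y) * ln (pmf P (x, y) / (?pX x * ?pY y))
          - pmf P (x, y) * ln (pmf P (x, y) / ?pY y / pmf (vf y) x)))"
    proof (intro sum.cong refl, clarify)
      fix x y
      show "pmf P (x, y) * real_of_ereal (g (x, y)) = kBT * (pmf P (x, y) * ln (pmf P (x, y) / (?pX x * ?pY y))
          - pmf P (x, y) * ln (pmf P (x, y) / ?pY y / pmf (vf y) x))"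
      \<comment> \<open>On the support all arguments of \<open>ln\<close> are positive and the
        logarithms split; off it the factor \<open>pmf P (x, y) = 0\<close> kills both
        sides.\<close>
      proof (cases "(x, y) \<in> set_pmf P")
        case True
        then have "pmf P (x, y) > 0"
          by (simp add: pmf_positive)
        then show ?thesis
          using pos[OF True] PX[of x] PY[of y]
          by (simp add: g_eq ln_div ln_mult algebra_simps)
      qed (simp add: set_pmf_iff)
    qed
    also have "\<dots> = kBT * (mutual_inf P - (\<Sum>(x, y)\<in>UNIV. pmf P (x, y) * ln (pmf P (x, y) / ?pY y / pmf (vf y) x)))"
      by (simp add: mutual_inf_eq_sum sum_subtractf sum_distrib_left split_beta' right_diff_distrib)
    finally show ?thesis
      using E False S by simp
  qed
qed

text \<open>Existence of an optimal \<open>vf\<close> makes the supremum a maximum, and existence of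
  minimizers makes each infimum a minimum. The last conjunct asks for finite minima because an
  infinite one gives every allowed \<open>vf\<close> the value \<open>-\<infinity>\<close>, so all
  are optimal, even those that fail to minimize at another \<open>y\<close>.\<close>

theorem mainTheorem6:
  fixes M :: "'w measure"
    and X Y :: "nat \<Rightarrow> 'w \<Rightarrow> part"
    and PXY :: "(part \<times> part) pmf"
    and V :: "part pmf set"
    and kBT :: real
    and n :: nat
  defines "EW \<equiv> \<lambda>vf. expectation_ereal M (work kBT (map_pmf fst PXY) vf n X Y)"
    and "allowed \<equiv> \<lambda>vf. \<forall>y::part. vf y \<in> V"
    and "minimizer \<equiv> \<lambda>y. is_arg_min (KL_div (cond_X PXY y)) (\<lambda>v. v \<in> V)"
  assumes "prob_space M"
    and "n \<ge> 1"
    and "kBT > 0"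
    and "iid_pairs M n X Y PXY"
    and "\<And>x. pmf (map_pmf fst PXY) x > 0"
    and "\<And>y. pmf (map_pmf snd PXY) y > 0"
    and "V \<noteq> {}"
    and "\<And>y. \<exists>v. minimizer y v"
  shows "(\<exists>vf. is_arg_max EW allowed vf) \<and>
    (SUP vf\<in>{vf. allowed vf}. EW vf) =
      ereal (real n * kBT) *
        (ereal (mutual_inf PXY)
          - (\<Sum>y\<in>UNIV. ereal (pmf (map_pmf snd PXY) y) * (INF v\<in>V. KL_div (cond_X PXY y) v))) \<and>
    (\<forall>vf. (\<forall>y. minimizer y (vf y)) \<longrightarrow> is_arg_max EW allowed vf) \<and>
    ((\<forall>y. (INF v\<in>V. KL_div (cond_X PXY y) v) \<noteq> \<infinity>) \<longrightarrow>
      (\<forall>vf. is_arg_max EW allowed vf \<longrightarrow> (\<forall>y. minimizer y (vf y))))"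
proof -
  interpret prob_space M by fact
  let ?D = "\<lambda>y. KL_div (cond_X PXY y)" and ?pY = "pmf (map_pmf snd PXY)"
  define J where "J vf = (\<Sum>y\<in>UNIV. ereal (?pY y) * ?D y (vf y))" for vf
  define k where "k = real n * kBT"
  have EW: "EW vf = ereal k * (ereal (mutual_inf PXY) - J vf)" for vf
    unfolding EW_def J_def k_def by (rule expectation_work) fact+
  have "k > 0"
    unfolding k_def using \<open>n \<ge> 1\<close> \<open>kBT > 0\<close> by simp
  have term_MInf: "ereal (?pY y) * ?D y v \<noteq> -\<infinity>" for y v
    using KL_div_neq_MInf[of "cond_X PXY y" v] \<open>?pY y > 0\<close> by (cases "?D y v") auto
  have J_MInf: "J vf \<noteq> -\<infinity>" for vf
    unfolding J_def by (rule sum_ereal_neq_MInf) (rule term_MInf)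
  \<comment> \<open>As \<open>k > 0\<close> and \<open>J\<close> is never
    \<open>-\<infinity>\<close>, the expected work is strictly decreasing in \<open>J\<close>, with
    \<open>J = \<infinity>\<close> sent to \<open>-\<infinity>\<close>. Maximizing it is therefore
    minimizing \<open>J\<close>.\<close>
  have EW_less_iff: "EW vf < EW vf' \<longleftrightarrow> J vf' < J vf" for vf vf'
    using \<open>k > 0\<close> J_MInf[of vf] J_MInf[of vf'] unfolding EW
    by (cases "J vf"; cases "J vf'") (auto simp: mult_less_cancel_left_pos)
  have minimizer_le: "?D y v \<le> ?D y v'" if "minimizer y v" "v' \<in> V" for y v v'
    using that by (auto simp: minimizer_def is_arg_min_def not_less)
  have INF_eq: "(INF v\<in>V. ?D y v) = ?D y v" if "minimizer y v" for y v
    using that minimizer_le[OF that]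
    by (intro antisym INF_lower INF_greatest) (auto simp: minimizer_def is_arg_min_def)
  have J_mono: "J vf \<le> J vf'" if "\<And>y. minimizer y (vf y)" "allowed vf'" for vf vf'
    unfolding J_def using that by (intro sum_mono ereal_mult_left_mono minimizer_le) (auto simp: allowed_def)
  have opt: "is_arg_max EW allowed vf" if "\<And>y. minimizer y (vf y)" for vf
  proof -
    have "allowed vf"
      using that by (simp add: allowed_def minimizer_def is_arg_min_def)
    then show ?thesis
      using J_mono[OF that] by (auto simp: is_arg_max_def EW_less_iff not_less)
  qed
  \<comment> \<open>The constraint acts on each \<open>y\<close> separately, so minimizers chosen
    for the individual \<open>y\<close> combine into one allowed protocol.\<close>
  obtain vf0 where vf0: "\<And>y. minimizer y (vf0 y)"
    using assms(11) by metis
  have allowed0: "allowed vf0"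
    using opt[OF vf0] by (simp add: is_arg_max_def)
  have "(SUP vf\<in>{vf. allowed vf}. EW vf) = EW vf0"
    using opt[OF vf0] allowed0 by (intro antisym SUP_least SUP_upper) (auto simp: is_arg_max_def not_less)
  moreover have "J vf0 = (\<Sum>y\<in>UNIV. ereal (?pY y) * (INF v\<in>V. ?D y v))"
    by (simp add: J_def INF_eq[OF vf0])
  moreover have "minimizer y (vf y)"
    if fin: "\<And>y. (INF v\<in>V. ?D y v) \<noteq> \<infinity>" and max: "is_arg_max EW allowed vf" for vf y
  proof (rule ccontr)
    assume not_min: "\<not> minimizer y (vf y)"
    have allowed: "allowed vf" and "J vf \<le> J vf0"
      using max allowed0 by (auto simp: is_arg_max_def EW_less_iff not_less)
    \<comment> \<open>Finiteness is what lets a strict gain at a single \<open>y\<close> survive in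
      the whole sum.\<close>
    have "J vf0 \<noteq> \<infinity>"
      using fin unfolding J_def INF_eq[OF vf0] by (auto simp: sum_Pinfty ereal_mult_eq_PInfty)
    obtain v where "v \<in> V" "?D y v < ?D y (vf y)"
      using not_min allowed by (auto simp: minimizer_def is_arg_min_def allowed_def)
    then have "?D y (vf0 y) < ?D y (vf y)"
      using minimizer_le[OF vf0] le_less_trans by blast
    then have less: "ereal (?pY y) * ?D y (vf0 y) < ereal (?pY y) * ?D y (vf y)"
      using \<open>?pY y > 0\<close> by (simp add: ereal_mult_strict_left_mono)
    \<comment> \<open>The \<open>y\<close> in \<open>UNIV - {y}\<close> is the fixed outcome at
      which \<open>vf\<close> fails to minimize. Passing to \<open>vf0\<close> strictly lowers that
      term and does not raise the remainder \<open>?R\<close>, which is finite for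
      \<open>vf0\<close>; hence \<open>J\<close> drops strictly, against the optimality of
      \<open>vf\<close>.\<close>
    let ?R = "\<lambda>vf. \<Sum>y\<in>UNIV - {y}. ereal (?pY y) * ?D y (vf y)"
    have split: "J vf = ereal (?pY y) * ?D y (vf y) + ?R vf" for vf
      unfolding J_def by (rule sum.remove) auto
    have "?R vf0 \<le> ?R vf"
      using vf0 allowed by (intro sum_mono ereal_mult_left_mono minimizer_le) (auto simp: allowed_def)
    moreover have "?R vf0 \<noteq> \<infinity>"
      using split[of vf0] \<open>J vf0 \<noteq> \<infinity>\<close> by auto
    moreover have "?R vf0 \<noteq> -\<infinity>"
      by (rule sum_ereal_neq_MInf) (rule term_MInf)
    ultimately have "J vf0 < J vf"
      unfolding split using less term_MInf[of y "vf0 y"]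
      by (cases "ereal (?pY y) * ?D y (vf0 y)"; cases "ereal (?pY y) * ?D y (vf y)";
          cases "?R vf0"; cases "?R vf") auto
    with \<open>J vf \<le> J vf0\<close> show False
      by simp
  qed
  ultimately show ?thesis
    using opt opt[OF vf0] EW[of vf0] unfolding k_def by metis
qed

end
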